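(* Let $S,T\in\mathcal{L}(\mathcal{H})$ be selfadjoint operators and let $S=S_1-S_2$ and $T=T_1-T_2$, where $S_1,S_2,T_1,T_2\in\mathcal{L}(\mathcal{H})$ are positive semidefinite operators with closed range. Suppose that $\mathcal{R}(T_1)\perp\mathcal{R}(S_2)$ and $\mathcal{R}(T_2)\perp\mathcal{R}(S_1)$. Then any two of the following conditions imply the third: 1. $S\leq T$; 2. $T_1^\dagger-T_2^\dagger\leq S_1^\dagger-S_2^\dagger$; 3. $\mathcal{R}(S_1+T_2)\cap\mathcal{N}(T_1+S_2)=\{0\}$ and $\mathcal{R}(T_1+S_2)\cap\mathcal{N}(S_1+T_2)=\{0\}$.
   Context: $\mathcal{H}$ is a complex Hilbert space and $\mathcal{L}(\mathcal{H})$ is the algebra of bounded linear operators on $\mathcal{H}$. $\mathcal{R}(A)$ and $\mathcal{N}(A)$ denote the range and nullspace of $A$. For selfadjoint $A,B$, $A\leq B$ (Löwner order) means $\langle Ax,x\rangle\leq\langle Bx,x\rangle$ for all $x\in\mathcal{H}$; $A$ is positive semidefinite if $A\geq 0$. For $A\in\mathcal{L}(\mathcal{H})$ with closed range, $A^\dagger\in\mathcal{L}(\mathcal{H})$ is the Moore-Penrose inverse, the unique $X\in\mathcal{L}(\mathcal{H})$ with $AXA=A$, $XAX=X$, $AX=P_{\mathcal{R}(A)}$, $XA=P_{\mathcal{R}(A^* )}$, where $P_{\mathcal{V}}$ denotes the orthogonal projection onto the closed subspace $\mathcal{V}$. *)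

theory Defs
  imports "HOL-Analysis.Analysis"
begin

text \<open>
  Complex inner product spaces extend the library class of real inner product spaces, so that norm,
  topology and bounded linear maps are the library's. Since the real inner product is required to be
  the real part of the complex one, it is determined by it, and
  \<open>norm x ^ 2 = Re (cinner x x) = cinner x x\<close>; positive definiteness of \<open>cinner\<close> is inherited
  from \<open>real_inner\<close>. The form \<open>cinner\<close> is linear in its first argument.
\<close>

class complex_inner = real_inner +
  fixes scaleC :: "complex \<Rightarrow> 'a \<Rightarrow> 'a"  (infixr "*\<^sub>C" 75)
    and cinner :: "'a \<Rightarrow> 'a \<Rightarrow> complex"
  assumes scaleC_add_right: "c *\<^sub>C (x + y) = c *\<^sub>C x + c *\<^sub>C y"
    and scaleC_add_left: "(c + d) *\<^sub>C x = c *\<^sub>C x + d *\<^sub>C x"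
    and scaleC_scaleC: "c *\<^sub>C (d *\<^sub>C x) = (c * d) *\<^sub>C x"
    and scaleC_complex_of_real: "complex_of_real r *\<^sub>C x = r *\<^sub>R x"
    and cinner_commute: "cinner x y = cnj (cinner y x)"
    and cinner_add_left: "cinner (x + y) z = cinner x z + cinner y z"
    and cinner_scaleC_left: "cinner (c *\<^sub>C x) y = c * cinner x y"
    and inner_eq_Re_cinner: "inner x y = Re (cinner x y)"

class chilbert_space = complex_inner + banach

text \<open>
  The type \<open>'a \<Rightarrow>\<^sub>L 'a\<close> consists of the real-linear bounded maps; the algebra of bounded operators of
  the complex Hilbert space is its subset of complex-homogeneous maps.
\<close>

definition bounded_ops :: "('a::chilbert_space \<Rightarrow>\<^sub>L 'a) set" where
  "bounded_ops = {A. \<forall>c x. blinfun_apply A (c *\<^sub>C x) = c *\<^sub>C blinfun_apply A x}"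

definition is_adjoint :: "('a::chilbert_space \<Rightarrow>\<^sub>L 'a) \<Rightarrow> ('a \<Rightarrow>\<^sub>L 'a) \<Rightarrow> bool" where
  "is_adjoint A B \<longleftrightarrow> (\<forall>x y. cinner (A x) y = cinner x (B y))"

definition adj :: "('a::chilbert_space \<Rightarrow>\<^sub>L 'a) \<Rightarrow> ('a \<Rightarrow>\<^sub>L 'a)" where
  "adj A = (THE B. B \<in> bounded_ops \<and> is_adjoint A B)"

definition selfadjoint :: "('a::chilbert_space \<Rightarrow>\<^sub>L 'a) \<Rightarrow> bool" where
  "selfadjoint A \<longleftrightarrow> A \<in> bounded_ops \<and> is_adjoint A A"

text \<open>
  The Loewner order is only meant for selfadjoint operators, for which \<open>cinner (A x) x\<close> is real;
  \<open>Re\<close> just moves this number to the type of reals.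
\<close>

definition loewner_le :: "('a::chilbert_space \<Rightarrow>\<^sub>L 'a) \<Rightarrow> ('a \<Rightarrow>\<^sub>L 'a) \<Rightarrow> bool"
    (infix "\<le>\<^sub>L" 50) where
  "A \<le>\<^sub>L B \<longleftrightarrow> (\<forall>x. Re (cinner (A x) x) \<le> Re (cinner (B x) x))"

definition pos_semidef :: "('a::chilbert_space \<Rightarrow>\<^sub>L 'a) \<Rightarrow> bool" where
  "pos_semidef A \<longleftrightarrow> selfadjoint A \<and> 0 \<le>\<^sub>L A"

abbreviation op_range :: "('a::chilbert_space \<Rightarrow>\<^sub>L 'a) \<Rightarrow> 'a set" where
  "op_range A \<equiv> range (blinfun_apply A)"

definition op_null :: "('a::chilbert_space \<Rightarrow>\<^sub>L 'a) \<Rightarrow> 'a set" where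
  "op_null A = {x. blinfun_apply A x = 0}"

definition orth_sets :: "'a::chilbert_space set \<Rightarrow> 'a set \<Rightarrow> bool" where
  "orth_sets V W \<longleftrightarrow> (\<forall>v\<in>V. \<forall>w\<in>W. cinner v w = 0)"

text \<open>Orthogonal projection onto \<open>V\<close>, meaningful when \<open>V\<close> is a closed complex subspace.\<close>

definition orth_proj :: "'a::chilbert_space set \<Rightarrow> 'a \<Rightarrow> 'a" where
  "orth_proj V x = (THE p. p \<in> V \<and> (\<forall>v\<in>V. cinner (x - p) v = 0))"

text \<open>Moore-Penrose inverse, meaningful when \<open>A\<close> is in \<open>bounded_ops\<close> and has closed range.\<close>

definition mp_inverse :: "('a::chilbert_space \<Rightarrow>\<^sub>L 'a) \<Rightarrow> ('a \<Rightarrow>\<^sub>L 'a)" where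
  "mp_inverse A = (THE X. X \<in> bounded_ops
     \<and> A o\<^sub>L X o\<^sub>L A = A
     \<and> X o\<^sub>L A o\<^sub>L X = X
     \<and> blinfun_apply (A o\<^sub>L X) = orth_proj (op_range A)
     \<and> blinfun_apply (X o\<^sub>L A) = orth_proj (op_range (adj A)))"

end

theory Submission
  imports Defs
begin

text \<open>
  Put \<open>A = S1 + T2\<close> and \<open>B = T1 + S2\<close>. The first condition is \<open>A \<le> B\<close>. By the orthogonality
  of the ranges, the Moore-Penrose inverses add up, \<open>A\<^sup>+ = S1\<^sup>+ + T2\<^sup>+\<close> and \<open>B\<^sup>+ = T1\<^sup>+ + S2\<^sup>+\<close>, so the
  second condition is \<open>B\<^sup>+ \<le> A\<^sup>+\<close>. Each inequality gives an inclusion of nullspaces, which proves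
  the third condition. Conversely, if \<open>A \<le> B\<close> and the third condition holds, then \<open>A\<close> and \<open>B\<close> have
  the same range, and evaluating \<open>0 \<le> \<langle>A (u - w), u - w\<rangle>\<close> at \<open>u = B\<^sup>+ x\<close>, \<open>w = A\<^sup>+ x\<close> gives
  \<open>B\<^sup>+ \<le> A\<^sup>+\<close>. The remaining implication is the same statement for \<open>B\<^sup>+\<close> and \<open>A\<^sup>+\<close>.
\<close>

section \<open>Orthogonal projection and the Hellinger-Toeplitz theorem\<close>

text \<open>By the parallelogram law every minimizing sequence is Cauchy, because midpoints stay in
  the convex set. Completeness then takes the place of compactness.\<close>

lemma closest_point_exists_hilbert:
  fixes S :: "'a::{real_inner,banach} set"
  assumes conv: "convex S" and clo: "closed S" and ne: "S \<noteq> {}"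
  shows "\<exists>p\<in>S. \<forall>z\<in>S. dist x p \<le> dist x z"
proof -
  define d where "d = Inf ((\<lambda>z. (dist x z)\<^sup>2) ` S)"
  have bdd: "bdd_below ((\<lambda>z. (dist x z)\<^sup>2) ` S)"
    by (rule bdd_belowI[of _ 0]) auto
  have d_le: "d \<le> (dist x z)\<^sup>2" if "z \<in> S" for z
    unfolding d_def using that by (intro cInf_lower bdd) auto
  have "\<exists>z\<in>S. (dist x z)\<^sup>2 < d + inverse (real (Suc n))" for n
    using cInf_lessD[of "(\<lambda>z. (dist x z)\<^sup>2) ` S" "d + inverse (real (Suc n))"] ne
    by (auto simp: d_def[symmetric])
  then obtain f where fS: "\<And>n. f n \<in> S"
    and fd: "\<And>n. (dist x (f n))\<^sup>2 < d + inverse (real (Suc n))"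
    by metis
  have key: "(dist (f m) (f n))\<^sup>2 \<le> 2 * inverse (real (Suc m)) + 2 * inverse (real (Suc n))" for m n
  proof -
    define c where "c = (1/2) *\<^sub>R f m + (1/2) *\<^sub>R f n"
    have "c \<in> S"
      unfolding c_def using conv fS by (intro convexD) auto
    then have "d \<le> (dist x c)\<^sup>2" by (rule d_le)
    \<comment> \<open>Parallelogram law for \<open>x - f m\<close> and \<open>x - f n\<close>, whose
      sum is \<open>2 *\<^sub>R (x - c)\<close>.\<close>
    moreover have "(dist (f m) (f n))\<^sup>2 = 2 * (dist x (f m))\<^sup>2 + 2 * (dist x (f n))\<^sup>2 - 4 * (dist x c)\<^sup>2"
      unfolding c_def dist_norm power2_norm_eq_inner
      by (simp add: inner_diff_left inner_diff_right inner_add_left inner_add_right inner_commute field_simps)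
    ultimately show ?thesis using fd[of m] fd[of n] by linarith
  qed
  have "Cauchy f"
  proof (rule metric_CauchyI)
    fix e :: real assume "0 < e"
    then have "0 < e\<^sup>2 / 4" by simp
    then obtain N where N: "inverse (real (Suc N)) < e\<^sup>2 / 4"
      using reals_Archimedean by blast
    have "dist (f m) (f n) < e" if "N \<le> m" "N \<le> n" for m n
    proof -
      have "inverse (real (Suc m)) \<le> inverse (real (Suc N))" "inverse (real (Suc n)) \<le> inverse (real (Suc N))"
        using that by (auto intro!: le_imp_inverse_le)
      then have "(dist (f m) (f n))\<^sup>2 < e\<^sup>2" using key[of m n] N by linarith
      then show ?thesis using \<open>0 < e\<close> by (simp add: power2_less_imp_less)
    qed
    then show "\<exists>N. \<forall>m\<ge>N. \<forall>n\<ge>N. dist (f m) (f n) < e" by blast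
  qed
  then obtain p where p: "f \<longlonglongrightarrow> p"
    using Cauchy_convergent_iff convergent_def by blast
  have pS: "p \<in> S" using clo fS p closed_sequentially by blast
  have "(\<lambda>n. (dist x (f n))\<^sup>2) \<longlonglongrightarrow> (dist x p)\<^sup>2"
    by (intro tendsto_intros p)
  moreover have "(\<lambda>n. d + inverse (real (Suc n))) \<longlonglongrightarrow> d + 0"
    by (intro tendsto_intros LIMSEQ_inverse_real_of_nat)
  ultimately have "(dist x p)\<^sup>2 \<le> d + 0"
    by (rule LIMSEQ_le) (use fd less_imp_le in blast)
  then have "(dist x p)\<^sup>2 \<le> (dist x z)\<^sup>2" if "z \<in> S" for z
    using d_le[OF that] by linarith
  then have "dist x p \<le> dist x z" if "z \<in> S" for z
    using that zero_le_dist power2_le_imp_le by blast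
  with pS show ?thesis by blast
qed

text \<open>The variational inequality at the closest point \<open>p\<close>, tested at
  \<open>p + v\<close> and \<open>p - v\<close>, gives both signs.\<close>

lemma orthogonal_projection_exists:
  fixes S :: "'a::{real_inner,banach} set"
  assumes sub: "subspace S" and clo: "closed S"
  shows "\<exists>p\<in>S. \<forall>v\<in>S. inner (x - p) v = 0"
proof -
  have conv: "convex S" using sub by (rule subspace_imp_convex)
  obtain p where p: "p \<in> S" "\<forall>z\<in>S. dist x p \<le> dist x z"
    using closest_point_exists_hilbert[OF conv clo] subspace_0[OF sub] by blast
  have "inner (x - p) v = 0" if "v \<in> S" for v
  proof -
    have "inner (x - p) (y - p) \<le> 0" if "y \<in> S" for y
      using any_closest_point_dot[OF conv clo p(1) that p(2)] .
    from this[of "p + v"] this[of "p - v"] show ?thesis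
      using sub p(1) that by (simp add: subspace_add subspace_diff)
  qed
  with p show ?thesis by blast
qed

text \<open>Symmetry writes each sublevel set \<open>F n\<close> as an intersection of closed
  half-spaces. These sets cover the space, so by Baire one contains a ball, and linearity turns this
  into a bound. This makes a pointwise constructed inverse bounded.\<close>

lemma hellinger_toeplitz:
  fixes f :: "'a::{real_inner,banach} \<Rightarrow> 'a"
  assumes lin: "linear f" and sym: "\<And>x y. inner (f x) y = inner x (f y)"
  shows "bounded_linear f"
proof -
  define F where "F n = {x. norm (f x) \<le> real n}" for n
  have F_eq: "F n = (\<Inter>y. {x. inner x (f y) \<le> real n * norm y})" for n
  proof (intro set_eqI iffI)
    fix x assume "x \<in> F n"
    then have "inner x (f y) \<le> real n * norm y" for y
      using norm_cauchy_schwarz[of "f x" y] mult_right_mono[of "norm (f x)" "real n" "norm y"]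
      by (simp add: F_def sym)
    then show "x \<in> (\<Inter>y. {x. inner x (f y) \<le> real n * norm y})" by blast
  next
    fix x assume "x \<in> (\<Inter>y. {x. inner x (f y) \<le> real n * norm y})"
    \<comment> \<open>The instance \<open>y = f x\<close>.\<close>
    then have "inner (f x) (f x) \<le> real n * norm (f x)"
      by (simp add: sym)
    then have "norm (f x) * norm (f x) \<le> real n * norm (f x)"
      by (simp add: power2_norm_eq_inner[symmetric] power2_eq_square)
    then show "x \<in> F n"
      by (cases "f x = 0") (auto simp: F_def)
  qed
  have closedF: "closed (F n)" for n
    unfolding F_eq by (intro closed_INT ballI closed_Collect_le continuous_intros)
  have UN: "\<Union> (range F) = UNIV"
    by (auto simp: F_def intro: real_arch_simple)
  have "\<exists>n. interior (F n) \<noteq> {}"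
  proof (rule ccontr)
    assume "\<not> ?thesis"
    then have "euclidean interior_of \<Union> (range F) = {}"
      by (intro Baire_category_alt disjI1 completely_metrizable_space_euclidean)
        (auto simp: closedF euclidean_interior_of)
    then show False unfolding UN by simp
  qed
  then obtain n a e where "0 < e" and ball: "ball a e \<subseteq> F n"
    by (metis all_not_in_conv mem_interior)
  have "norm (f x) \<le> norm x * (4 * real n / e)" for x
  proof (cases "x = 0")
    case True
    then show ?thesis using linear_0[OF lin] by simp
  next
    case False
    \<comment> \<open>Scaled so that \<open>a + t *\<^sub>R x\<close> has distance
      \<open>e / 2\<close> from the centre.\<close>
    define t where "t = e / (2 * norm x)"
    have "t > 0" using False \<open>0 < e\<close> by (simp add: t_def)
    have "a + t *\<^sub>R x \<in> ball a e"
      using False \<open>0 < e\<close> by (simp add: t_def dist_norm)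
    then have "norm (f (a + t *\<^sub>R x)) \<le> n" using ball by (auto simp: F_def)
    moreover have "norm (f a) \<le> n" using ball \<open>0 < e\<close> centre_in_ball[of a e] unfolding F_def by blast
    moreover have "f (a + t *\<^sub>R x) - f a = t *\<^sub>R f x"
      by (simp add: linear_add[OF lin] linear_scale[OF lin])
    ultimately have "norm (t *\<^sub>R f x) \<le> 2 * n"
      using norm_triangle_ineq4[of "f (a + t *\<^sub>R x)" "f a"] by simp
    then have "t * norm (f x) \<le> 2 * n" using \<open>t > 0\<close> by simp
    then show ?thesis using \<open>0 < e\<close> False by (simp add: t_def field_simps)
  qed
  then show ?thesis
    using lin unfolding bounded_linear_def bounded_linear_axioms_def by blast
qed

section \<open>Positive operators and their Moore-Penrose inverses\<close>

text \<open>
  A positive operator with its Moore-Penrose inverse. For selfadjoint \<open>A\<close> the two projections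
  \<open>A X\<close> and \<open>X A\<close> coincide, which makes the conditions symmetric in \<open>A\<close> and \<open>X\<close>.
\<close>

locale positive_mp_pair =
  fixes A X :: "'a::real_inner \<Rightarrow>\<^sub>L 'a"
  assumes sym: "inner (A x) y = inner x (A y)"
    and sym': "inner (X x) y = inner x (X y)"
    and nonneg: "0 \<le> inner (A x) x"
    and nonneg': "0 \<le> inner (X x) x"
    and AXA: "A (X (A x)) = A x"
    and XAX: "X (A (X x)) = X x"
    and comm: "A (X x) = X (A x)"
begin

text \<open>This symmetry later reverses the implication between the two order conditions.\<close>

lemma dual: "positive_mp_pair X A"
  by (rule positive_mp_pair.intro) (fact sym sym' nonneg nonneg' AXA XAX comm[symmetric])+

lemma XAA: "X (A (A x)) = A x"
  by (metis AXA comm)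

lemma XXA: "X (X (A x)) = X x"
  by (metis XAX comm)

lemma null_iff: "X x = 0 \<longleftrightarrow> A x = 0"
  by (metis AXA XAX blinfun.zero_right comm)

lemma range_eq: "range X = range A"
proof
  show "range X \<subseteq> range A"
    by (metis XAX comm image_subset_iff rangeI)
  show "range A \<subseteq> range X"
    by (metis AXA comm image_subset_iff rangeI)
qed

end

section \<open>Order, nullspaces and inverses of positive operators\<close>

lemma positive_null_iff:
  fixes A :: "'a::real_inner \<Rightarrow>\<^sub>L 'a"
  assumes sym: "\<And>x y. inner (A x) y = inner x (A y)" and nonneg: "\<And>x. 0 \<le> inner (A x) x"
  shows "inner (A x) x = 0 \<longleftrightarrow> A x = 0"
proof
  assume 0: "inner (A x) x = 0"
  define q where "q = inner (A (A x)) (A x)"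
  define r where "r = inner (A x) (A x)"
  have "q \<ge> 0" unfolding q_def by (rule nonneg)
  \<comment> \<open>If \<open>A x\<close> were nonzero, the form would be negative at this vector.
    With \<open>q\<close> instead of \<open>q + 1\<close> the value would be
    \<open>- (r\<^sup>2 * q)\<close>, which says nothing when \<open>q = 0\<close>.\<close>
  have "0 \<le> inner (A ((q + 1) *\<^sub>R x - r *\<^sub>R A x)) ((q + 1) *\<^sub>R x - r *\<^sub>R A x)" by (rule nonneg)
  also have "\<dots> = - (r\<^sup>2 * (q + 2))"
  proof -
    have "inner (A (A x)) x = r" "inner (A x) (A x) = r" "inner (A (A x)) (A x) = q"
      by (simp_all add: q_def r_def sym)
    then show ?thesis
      using 0 by (simp add: blinfun.diff_right blinfun.add_right blinfun.scaleR_right inner_add_left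
        inner_add_right inner_diff_left inner_diff_right power2_eq_square algebra_simps)
  qed
  finally have "r\<^sup>2 * (q + 2) \<le> 0" by simp
  then have "r = 0" using \<open>q \<ge> 0\<close> by (simp add: mult_le_0_iff)
  then show "A x = 0" by (simp add: r_def)
qed simp

lemma null_antimono:
  fixes A B :: "'a::real_inner \<Rightarrow>\<^sub>L 'a"
  assumes "\<And>x y. inner (A x) y = inner x (A y)" and "\<And>x. 0 \<le> inner (A x) x"
    and "\<And>x. inner (A x) x \<le> inner (B x) x" and "B x = 0"
  shows "A x = 0"
  using positive_null_iff[OF assms(1,2)] assms(2)[of x] assms(3)[of x] assms(4) by simp

text \<open>The order puts the range of \<open>A\<close> inside that of \<open>B\<close>, and
  \<open>disj\<close> gives the reverse inclusion. Hence \<open>A o\<^sub>L X\<close> fixes the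
  range of \<open>B\<close>, and the claim follows by expanding one nonnegative square.\<close>

lemma mp_antimono:
  assumes "positive_mp_pair A X" and "positive_mp_pair B Y"
    and le: "\<And>x. inner (A x) x \<le> inner (B x) x"
    and disj: "\<And>x. x \<in> range B \<Longrightarrow> A x = 0 \<Longrightarrow> x = 0"
  shows "inner (Y x) x \<le> inner (X x) x"
proof -
  interpret A: positive_mp_pair A X by fact
  interpret B: positive_mp_pair B Y by fact
  have AYB: "A (Y (B z)) = A z" for z
  proof -
    have "A (z - Y (B z)) = 0"
      by (rule null_antimono[of A B, OF A.sym A.nonneg le]) (simp add: blinfun.diff_right B.AXA)
    then show ?thesis by (simp add: blinfun.diff_right)
  qed
  \<comment> \<open>The adjoint form of \<open>AYB\<close>: the projection
    \<open>B o\<^sub>L Y\<close> fixes the range of \<open>A\<close>.\<close>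
  have BYA: "B (Y (A z)) = A z" for z
  proof -
    have "inner (B (Y (A z))) w = inner (A z) w" for w
      by (simp add: A.sym B.sym B.sym' AYB)
    then show ?thesis using vector_eq_rdot by blast
  qed
  \<comment> \<open>The difference of the two sides lies in the range of \<open>B\<close> by
    \<open>BYA\<close> and is killed by \<open>A\<close>, so \<open>disj\<close> applies.\<close>
  have AXB: "A (X (B z)) = B z" for z
  proof -
    have "B z - A (X (B z)) = B (z - Y (A (X (B z))))"
      by (simp add: blinfun.diff_right BYA)
    then have "B z - A (X (B z)) \<in> range B" by (metis rangeI)
    then have "B z - A (X (B z)) = 0"
      by (rule disj) (simp add: blinfun.diff_right A.comm A.XAA)
    then show ?thesis by simp
  qed
  have AXY: "A (X (Y z)) = Y z" for z
    using AXB[of "Y (Y z)"] by (metis B.XAX B.comm)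
  \<comment> \<open>Expanding the form of \<open>A\<close> at \<open>u - w\<close> gives 0 \<le>
    \<open>inner (A u) u - 2 * inner (Y x) x + inner (X x) x\<close>, where the first term is at
    most \<open>inner (Y x) x\<close>.\<close>
  define u where "u = Y x"
  define w where "w = X x"
  have "inner (A w) u = inner (Y x) x"
  proof -
    have "inner (A (X x)) (Y x) = inner x (A (X (Y x)))"
      by (simp add: A.comm A.sym A.sym')
    then show ?thesis by (simp add: u_def w_def AXY B.sym')
  qed
  moreover have "inner (A w) w = inner (X x) x"
    unfolding w_def by (simp only: A.sym A.sym' A.XAX)
  moreover have "inner (A u) u \<le> inner (Y x) x"
    using le[of u] unfolding u_def by (simp only: B.sym B.sym' B.XAX)
  moreover have "0 \<le> inner (A (u - w)) (u - w)" by (rule A.nonneg)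
  moreover have "inner (A (u - w)) (u - w) = inner (A u) u - 2 * inner (A w) u + inner (A w) w"
    using A.sym[of u w] by (simp add: blinfun.diff_right inner_diff_left inner_diff_right inner_commute)
  ultimately show ?thesis by linarith
qed

text \<open>Orthogonality of the ranges makes every product of \<open>A\<close> or \<open>X\<close>
  with \<open>B\<close> or \<open>Y\<close> vanish, so only the diagonal terms remain.\<close>

lemma mp_pair_add:
  assumes "positive_mp_pair A X" and "positive_mp_pair B Y"
    and orth: "\<And>x y. inner (A x) (B y) = 0"
  shows "positive_mp_pair (A + B) (X + Y)"
proof -
  interpret A: positive_mp_pair A X by fact
  interpret B: positive_mp_pair B Y by fact
  have AB: "A (B x) = 0" and BA: "B (A x) = 0" for x
    by (metis A.sym inner_eq_zero_iff orth, metis B.sym inner_commute inner_eq_zero_iff orth)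
  have AY: "A (Y x) = 0" and BX: "B (X x) = 0" for x
    by (metis AB B.XAX B.comm, metis BA A.XAX A.comm)
  have XB: "X (B x) = 0" and YA: "Y (A x) = 0" and XY: "X (Y x) = 0" and YX: "Y (X x) = 0" for x
    by (simp_all add: A.null_iff B.null_iff AB BA AY BX)
  show ?thesis
  proof
    show "0 \<le> inner ((A + B) x) x" "0 \<le> inner ((X + Y) x) x" for x
      using A.nonneg[of x] B.nonneg[of x] A.nonneg'[of x] B.nonneg'[of x]
      by (simp_all add: plus_blinfun.rep_eq inner_add_left)
  qed (simp_all add: plus_blinfun.rep_eq blinfun.add_right inner_add_left inner_add_right
      A.sym B.sym A.sym' B.sym' AB BA AY BX XB YA XY YX A.comm B.comm A.XAA B.XAA A.XXA B.XXA)
qed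

section \<open>The complex structure\<close>

lemma cinner_diff_left: "cinner (x - y) z = cinner x z - cinner y (z::'a::complex_inner)"
  by (metis add_diff_cancel_right' cinner_add_left diff_add_cancel)

lemma cinner_zero_left: "cinner 0 (x::'a::complex_inner) = 0"
  by (metis cinner_diff_left diff_self)

lemma cinner_scaleC_right: "cinner x (c *\<^sub>C y) = cnj c * cinner x (y::'a::complex_inner)"
  by (metis cinner_commute cinner_scaleC_left complex_cnj_mult)

text \<open>The real inner product determines the complex one, so for complex-linear maps
  adjointness can be checked on real inner products.\<close>

lemma cinner_eq_inner: "cinner x y = Complex (inner x y) (inner x (\<i> *\<^sub>C (y::'a::complex_inner)))"
  by (simp add: complex_eq_iff inner_eq_Re_cinner cinner_scaleC_right)

lemma is_adjoint_iff_inner: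
  assumes "A \<in> bounded_ops" and "B \<in> bounded_ops"
  shows "is_adjoint A B \<longleftrightarrow> (\<forall>x y. inner (A x) y = inner x (B y))"
  using assms unfolding is_adjoint_def bounded_ops_def by (auto simp: cinner_eq_inner)

lemma selfadjoint_inner: "selfadjoint A \<Longrightarrow> inner (A x) y = inner x (A y)"
  using is_adjoint_iff_inner unfolding selfadjoint_def by blast

lemma adj_selfadjoint:
  assumes "selfadjoint A"
  shows "adj A = A"
  unfolding adj_def
proof (rule the_equality)
  show "A \<in> bounded_ops \<and> is_adjoint A A" using assms by (simp add: selfadjoint_def)
  fix B assume "B \<in> bounded_ops \<and> is_adjoint A B"
  then have "inner x (B y) = inner x (A y)" for x y
    using assms by (metis is_adjoint_iff_inner selfadjoint_def)
  then show "B = A"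
    by (metis blinfun_eqI inner_eq_zero_iff inner_diff_right right_minus_eq)
qed

section \<open>Identification and existence of the Moore-Penrose inverse\<close>

lemma orth_projI:
  assumes "p \<in> V" and "subspace V" and "\<And>v. v \<in> V \<Longrightarrow> cinner (x - p) v = 0"
  shows "orth_proj V x = p"
  unfolding orth_proj_def
proof (rule the_equality)
  show "p \<in> V \<and> (\<forall>v\<in>V. cinner (x - p) v = 0)" using assms by blast
  fix q assume q: "q \<in> V \<and> (\<forall>v\<in>V. cinner (x - q) v = 0)"
  have "q - p \<in> V" using assms q by (simp add: subspace_diff)
  then have "cinner (x - p) (q - p) = 0" "cinner (x - q) (q - p) = 0"
    using assms q by auto
  then have "inner (q - p) (q - p) = 0"
    by (simp add: inner_eq_Re_cinner cinner_diff_left)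
  then show "q = p" by simp
qed

lemma mp_inverse_eq:
  assumes sa: "selfadjoint A" and X: "X \<in> bounded_ops" and "positive_mp_pair A X"
  shows "mp_inverse A = X"
proof -
  interpret positive_mp_pair A X by fact
  have adjA: "adj A = A" using sa by (rule adj_selfadjoint)
  have sub: "subspace (op_range A)"
    using blinfun.bounded_linear_right bounded_linear.linear linear_subspace_image subspace_UNIV by blast
  have proj: "orth_proj (op_range A) x = A (X x)" for x
  proof (rule orth_projI[OF _ sub])
    fix v assume "v \<in> op_range A"
    then obtain z where z: "v = A z" by blast
    have "cinner (x - A (X x)) (A z) = cinner (A (x - A (X x))) z"
      using sa by (simp add: selfadjoint_def is_adjoint_def)
    also have "\<dots> = 0"
      by (simp add: blinfun.diff_right comm XAA cinner_zero_left)
    finally show "cinner (x - A (X x)) v = 0" by (simp add: z)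
  qed simp
  show ?thesis
    unfolding mp_inverse_def adjA
  proof (rule the_equality)
    show "X \<in> bounded_ops \<and> A o\<^sub>L X o\<^sub>L A = A \<and> X o\<^sub>L A o\<^sub>L X = X \<and>
        blinfun_apply (A o\<^sub>L X) = orth_proj (op_range A) \<and> blinfun_apply (X o\<^sub>L A) = orth_proj (op_range A)"
      using X by (auto intro!: blinfun_eqI simp: proj XAA XXA comm fun_eq_iff)
    fix Y
    assume Y: "Y \<in> bounded_ops \<and> A o\<^sub>L Y o\<^sub>L A = A \<and> Y o\<^sub>L A o\<^sub>L Y = Y \<and>
        blinfun_apply (A o\<^sub>L Y) = orth_proj (op_range A) \<and> blinfun_apply (Y o\<^sub>L A) = orth_proj (op_range A)"
    then have AY: "A (Y x) = A (X x)" and YA: "Y (A x) = A (X x)" and YAY: "Y (A (Y x)) = Y x" for x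
      by (metis proj blinfun_apply_blinfun_compose)+
    have "Y x = X x" for x
    proof -
      \<comment> \<open>A competitor \<open>Y\<close> has the same products with \<open>A\<close> on
        both sides, and \<open>Y = Y A Y\<close> then forces \<open>Y = X\<close>.\<close>
      have "Y x = A (X (Y x))" using YAY YA by metis
      also have "\<dots> = X (A (X x))" by (simp only: comm AY)
      finally show ?thesis by (simp only: XAX)
    qed
    then show "Y = X" by (rule blinfun_eqI)
  qed
qed

text \<open>Closed range splits the space into range and nullspace of \<open>A\<close>, so
  \<open>A\<close> is bijective on its range. Projecting onto the range and inverting there gives a
  symmetric linear map, which is bounded by \<open>hellinger_toeplitz\<close>.\<close>

lemma positive_mp_pair_exists:
  assumes psd: "pos_semidef A" and clo: "closed (op_range A)"
  shows "\<exists>X \<in> bounded_ops. positive_mp_pair A X"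
proof -
  have sa: "selfadjoint A" and A: "A (c *\<^sub>C x) = c *\<^sub>C A x" for c x
    using psd by (simp_all add: pos_semidef_def selfadjoint_def bounded_ops_def)
  have sym: "inner (A x) y = inner x (A y)" for x y
    using sa by (rule selfadjoint_inner)
  have nonneg: "0 \<le> inner (A x) x" for x
    using psd by (simp add: pos_semidef_def loewner_le_def inner_eq_Re_cinner cinner_zero_left)
  have null2: "A x = 0" if "A (A x) = 0" for x
    using that by (metis inner_eq_zero_iff inner_zero_left sym)
  have sub: "subspace (op_range A)"
    using blinfun.bounded_linear_right bounded_linear.linear linear_subspace_image subspace_UNIV by blast
  \<comment> \<open>Take \<open>A u\<close> to be the projection of \<open>x\<close> onto the range;
    the residual is orthogonal to the range and so is killed by \<open>A\<close>.\<close>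
  have split: "\<exists>u. A (A u) = A x" for x
  proof -
    obtain u where "\<forall>v\<in>op_range A. inner (x - A u) v = 0"
      using orthogonal_projection_exists[OF sub clo, of x] by blast
    then have "inner (A (x - A u)) (A (x - A u)) = 0" by (simp add: sym)
    then show ?thesis by (auto simp: blinfun.diff_right)
  qed
  have inj: "u = v" if "u \<in> op_range A" "v \<in> op_range A" "A u = A v" for u v
  proof -
    obtain a b where "u = A a" "v = A b" using \<open>u \<in> _\<close> \<open>v \<in> _\<close> by blast
    then have "A (A (a - b)) = 0" using \<open>A u = A v\<close> by (simp add: blinfun.diff_right)
    then have "A (a - b) = 0" by (rule null2)
    then show ?thesis using \<open>u = A a\<close> \<open>v = A b\<close> by (simp add: blinfun.diff_right)
  qed
  have "\<exists>u. u \<in> op_range A \<and> A (A u) = A x" for x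
  proof -
    \<comment> \<open>The second use of \<open>split\<close> replaces \<open>u\<close> by
      \<open>A v\<close>, which lies in the range.\<close>
    obtain u v where "A (A u) = A x" "A (A v) = A u" using split by meson
    then have "A (A (A v)) = A x" by simp
    then show ?thesis by blast
  qed
  then obtain f where fR: "\<And>x. f x \<in> op_range A" and Af: "\<And>x. A (A (f x)) = A x"
    by metis
  have f_eqI: "f x = u" if "u \<in> op_range A" "A (A u) = A x" for x u
  proof -
    have "A (f x) = A u" by (rule inj) (simp_all add: Af that(2))
    with fR that(1) show ?thesis by (rule inj)
  qed
  have f_add: "f (x + y) = f x + f y" for x y
    using sub fR by (intro f_eqI) (auto simp: subspace_add blinfun.add_right Af)
  have f_scaleC: "f (c *\<^sub>C x) = c *\<^sub>C f x" for c x
  proof (rule f_eqI)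
    show "c *\<^sub>C f x \<in> op_range A" using fR by (metis A imageE rangeI)
  qed (simp add: A Af)
  have "linear f"
    by (rule linearI) (simp_all add: f_add f_scaleC[of "complex_of_real r" for r, unfolded scaleC_complex_of_real])
  \<comment> \<open>\<open>A (f y)\<close> is the projection of \<open>y\<close> onto the range,
    where \<open>f x\<close> lies.\<close>
  have f_inner: "inner (f x) (A (f y)) = inner (f x) y" for x y
  proof -
    obtain z where "f x = A z" using fR by blast
    then show ?thesis by (simp add: sym Af)
  qed
  then have f_sym: "inner (f x) y = inner x (f y)" for x y
    using f_inner[of x y] f_inner[of y x] sym[of "f x" "f y"] by (simp add: inner_commute)
  have bl: "bounded_linear f"
    using \<open>linear f\<close> f_sym by (rule hellinger_toeplitz)
  define X where "X = Blinfun f"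
  have X: "X x = f x" for x by (simp add: X_def bounded_linear_Blinfun_apply[OF bl])
  have comm: "A (f x) = f (A x)" for x
    by (rule f_eqI[symmetric]) (simp_all add: Af)
  have AfA: "A (f (A x)) = A x" for x
    by (rule inj) (simp_all add: Af)
  have fAf: "f (A (f x)) = f x" for x
    by (rule f_eqI[OF fR refl])
  have f_nonneg: "0 \<le> inner (f x) x" for x
    using nonneg[of "f x"] f_inner[of x x] by (simp add: inner_commute)
  have "positive_mp_pair A X"
    by (rule positive_mp_pair.intro; (unfold X)?) (fact sym f_sym nonneg f_nonneg AfA fAf comm)+
  moreover have "X \<in> bounded_ops" by (simp add: bounded_ops_def X f_scaleC)
  ultimately show ?thesis by blast
qed

lemma positive_mp_pair_mp_inverse:
  assumes "pos_semidef A" and "closed (op_range A)"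
  shows "positive_mp_pair A (mp_inverse A)"
  using positive_mp_pair_exists[OF assms] mp_inverse_eq assms(1) by (metis pos_semidef_def)

lemma inner_eq_0_of_orth_sets: "orth_sets V W \<Longrightarrow> v \<in> V \<Longrightarrow> w \<in> W \<Longrightarrow> inner v w = 0"
  by (simp add: orth_sets_def inner_eq_Re_cinner)

section \<open>The three implications\<close>

theorem theorem4p3:
  fixes S T S1 S2 T1 T2 :: "'a::chilbert_space \<Rightarrow>\<^sub>L 'a"
  assumes "selfadjoint S" and "selfadjoint T"
    and "S = S1 - S2" and "T = T1 - T2"
    and "pos_semidef S1" and "pos_semidef S2" and "pos_semidef T1" and "pos_semidef T2"
    and "closed (op_range S1)" and "closed (op_range S2)"
    and "closed (op_range T1)" and "closed (op_range T2)"
    and "orth_sets (op_range T1) (op_range S2)"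
    and "orth_sets (op_range T2) (op_range S1)"
  shows "let cond1 = S \<le>\<^sub>L T;
             cond2 = mp_inverse T1 - mp_inverse T2 \<le>\<^sub>L mp_inverse S1 - mp_inverse S2;
             cond3 = (op_range (S1 + T2) \<inter> op_null (T1 + S2) = {0} \<and>
                      op_range (T1 + S2) \<inter> op_null (S1 + T2) = {0})
         in (cond1 \<and> cond2 \<longrightarrow> cond3) \<and> (cond1 \<and> cond3 \<longrightarrow> cond2) \<and> (cond2 \<and> cond3 \<longrightarrow> cond1)"
proof -
  define A where "A = S1 + T2"
  define B where "B = T1 + S2"
  define X where "X = mp_inverse S1 + mp_inverse T2"
  define Y where "Y = mp_inverse T1 + mp_inverse S2"
  have "inner (S1 x) (T2 y) = 0" for x y
    using inner_eq_0_of_orth_sets[OF assms(14)] by (metis inner_commute rangeI)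
  then have AX: "positive_mp_pair A X"
    unfolding A_def X_def by (intro mp_pair_add positive_mp_pair_mp_inverse assms)
  have "inner (T1 x) (S2 y) = 0" for x y
    using inner_eq_0_of_orth_sets[OF assms(13)] by blast
  then have BY: "positive_mp_pair B Y"
    unfolding B_def Y_def by (intro mp_pair_add positive_mp_pair_mp_inverse assms)
  interpret A: positive_mp_pair A X by fact
  interpret B: positive_mp_pair B Y by fact
  \<comment> \<open>Moving the subtracted forms to the other side turns both inequalities into
    comparisons of positive operators.\<close>
  have c1: "S \<le>\<^sub>L T \<longleftrightarrow> (\<forall>x. inner (A x) x \<le> inner (B x) x)"
    unfolding loewner_le_def inner_eq_Re_cinner[symmetric] assms(3,4) A_def B_def
    by (intro all_cong1) (auto simp: plus_blinfun.rep_eq minus_blinfun.rep_eq inner_add_left inner_diff_left)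
  have c2: "mp_inverse T1 - mp_inverse T2 \<le>\<^sub>L mp_inverse S1 - mp_inverse S2
      \<longleftrightarrow> (\<forall>x. inner (Y x) x \<le> inner (X x) x)"
    unfolding loewner_le_def inner_eq_Re_cinner[symmetric] X_def Y_def
    by (intro all_cong1) (auto simp: plus_blinfun.rep_eq minus_blinfun.rep_eq inner_add_left inner_diff_left)
  have c3: "op_range (S1 + T2) \<inter> op_null (T1 + S2) = {0} \<and> op_range (T1 + S2) \<inter> op_null (S1 + T2) = {0}
      \<longleftrightarrow> (\<forall>x\<in>range A. B x = 0 \<longrightarrow> x = 0) \<and> (\<forall>x\<in>range B. A x = 0 \<longrightarrow> x = 0)"
  proof -
    have "0 \<in> range A" "0 \<in> range B" by (metis blinfun.zero_right rangeI)+
    then show ?thesis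
      unfolding A_def[symmetric] B_def[symmetric] op_null_def by (auto simp: blinfun.zero_right)
  qed
  \<comment> \<open>Since \<open>C o\<^sub>L Z\<close> fixes the range and commutes, a null vector
    in the range is zero.\<close>
  have range_null: "x = 0" if "positive_mp_pair C Z" "x \<in> range C" "C x = 0"
    for C Z :: "'a \<Rightarrow>\<^sub>L 'a" and x
  proof -
    interpret C: positive_mp_pair C Z by fact
    from \<open>x \<in> range C\<close> obtain z where "x = C z" by blast
    then show ?thesis using \<open>C x = 0\<close> by (metis C.AXA C.comm blinfun.zero_right)
  qed
  show ?thesis
    unfolding Let_def c1 c2 c3
  proof (intro conjI impI; elim conjE)
    assume le: "\<forall>x. inner (A x) x \<le> inner (B x) x" and le': "\<forall>x. inner (Y x) x \<le> inner (X x) x"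
    show "\<forall>x\<in>range A. B x = 0 \<longrightarrow> x = 0"
      using null_antimono[of A B, OF A.sym A.nonneg] le range_null[OF AX] by blast
    show "\<forall>x\<in>range B. A x = 0 \<longrightarrow> x = 0"
      using null_antimono[of Y X, OF B.sym' B.nonneg'] le' range_null[OF BY] A.null_iff B.null_iff by blast
  next
    assume "\<forall>x. inner (A x) x \<le> inner (B x) x" and "\<forall>x\<in>range B. A x = 0 \<longrightarrow> x = 0"
    then show "\<forall>x. inner (Y x) x \<le> inner (X x) x"
      using mp_antimono[OF AX BY] by blast
  next
    \<comment> \<open>Here \<open>Y\<close> and \<open>X\<close> play the roles of \<open>A\<close>
      and \<open>B\<close>; a pair shares its range and nullspace, which carries the intersection
      condition over.\<close>
    assume "\<forall>x. inner (Y x) x \<le> inner (X x) x" and "\<forall>x\<in>range A. B x = 0 \<longrightarrow> x = 0"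
    then show "\<forall>x. inner (A x) x \<le> inner (B x) x"
      using mp_antimono[OF B.dual A.dual] A.range_eq B.null_iff by blast
  qed
qed

end
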